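(* Let $\mathcal M\subset B(H)$ be a von Neumann algebra and let $a,b\in\mathcal M$ be isometries. Let $t\in\mathcal M$ be invertible such that $b=tat^{-1}$. Then there exists a unitary $u\in\mathcal M$ such that $b=uau^*$.
   Context: $B(H)$ is the algebra of bounded linear operators on a Hilbert space $H$. An isometry in $\mathcal M$ is an element $v$ with $v^*v=\mathbf 1$, where $\mathbf 1$ is the identity of $\mathcal M$ (the identity operator on $H$). *)

theory Defs
  imports "HOL-Analysis.Analysis"
begin

section \<open>Complex Hilbert spaces\<close>

text \<open>
  A complex Hilbert space is a complete real inner product space (so that its norm, its topology
  and the type of bounded real-linear operators are those of the library) with a complex scalar
  multiplication extending the real one and a sesquilinear product whose real part is the real
  inner product.  The product is linear in the first argument and conjugate linear in the second.
  Positivity and the norm formula come from the class \<^class>\<open>real_inner\<close>.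
\<close>

class complex_hilbert_space = real_inner + complete_space +
  fixes scaleC :: "complex \<Rightarrow> 'a \<Rightarrow> 'a"  (infixr \<open>*\<^sub>C\<close> 75)
    and cinner :: "'a \<Rightarrow> 'a \<Rightarrow> complex"
  assumes scaleC_add_right: "c *\<^sub>C (x + y) = c *\<^sub>C x + c *\<^sub>C y"
    and scaleC_add_left: "(c + d) *\<^sub>C x = c *\<^sub>C x + d *\<^sub>C x"
    and scaleC_scaleC: "c *\<^sub>C (d *\<^sub>C x) = (c * d) *\<^sub>C x"
    and scaleC_of_real: "complex_of_real r *\<^sub>C x = r *\<^sub>R x"
    and cinner_commute: "cinner x y = cnj (cinner y x)"
    and cinner_add_left: "cinner (x + y) z = cinner x z + cinner y z"
    and cinner_scaleC_left: "cinner (c *\<^sub>C x) y = c * cinner x y"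
    and inner_eq_Re_cinner: "inner x y = Re (cinner x y)"

instantiation complex :: complex_hilbert_space
begin

definition scaleC_complex_def: "scaleC c x = c * (x :: complex)"

definition cinner_complex_def: "cinner x y = x * cnj (y :: complex)"

instance
  by standard
    (auto simp: scaleC_complex_def cinner_complex_def inner_complex_def algebra_simps scaleR_conv_of_real)

end

lemma cinner_self: "cinner x x = complex_of_real ((norm x)\<^sup>2)"
proof -
  have "Im (cinner x x) = 0"
    using arg_cong[OF cinner_commute[of x x], of Im] by simp
  then show ?thesis
    by (simp add: complex_eq_iff power2_norm_eq_inner inner_eq_Re_cinner)
qed

lemma cinner_eq_inner:
  "cinner x y = Complex (inner x y) (- inner (\<i> *\<^sub>C x) y)"
  by (simp add: complex_eq_iff inner_eq_Re_cinner cinner_scaleC_left)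

lemma norm_scaleC: "norm (c *\<^sub>C x) = cmod c * norm x"
proof -
  have "cinner (c *\<^sub>C x) (c *\<^sub>C x) = c * cnj c * cinner x x"
    by (metis cinner_commute cinner_scaleC_left complex_cnj_mult mult.assoc)
  then have "complex_of_real ((norm (c *\<^sub>C x))\<^sup>2) = complex_of_real ((cmod c * norm x)\<^sup>2)"
    by (simp add: cinner_self complex_norm_square[symmetric] power_mult_distrib
        flip: of_real_mult of_real_power)
  then have "(norm (c *\<^sub>C x))\<^sup>2 = (cmod c * norm x)\<^sup>2"
    unfolding of_real_eq_iff .
  then show ?thesis
    by simp
qed

lemma bounded_linear_scaleC_right: "bounded_linear (\<lambda>x. c *\<^sub>C x)"
proof (rule bounded_linear_intro[where K = "cmod c"])
  show "c *\<^sub>C (r *\<^sub>R x) = r *\<^sub>R (c *\<^sub>C x)" for r and x :: 'a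
    by (simp add: scaleC_scaleC mult.commute flip: scaleC_of_real)
qed (auto simp: scaleC_add_right norm_scaleC mult.commute)


section \<open>Bounded operators and their adjoints\<close>

text \<open>The elements of the type \<open>'h \<Rightarrow>\<^sub>L 'h\<close> are only real-linear, hence the explicit carrier.\<close>

definition bounded_operators :: "('h::complex_hilbert_space \<Rightarrow>\<^sub>L 'h) set" where
  "bounded_operators = {T. \<forall>c x. blinfun_apply T (c *\<^sub>C x) = c *\<^sub>C blinfun_apply T x}"

definition scale_operator ::
  "complex \<Rightarrow> ('h::complex_hilbert_space \<Rightarrow>\<^sub>L 'h) \<Rightarrow> ('h \<Rightarrow>\<^sub>L 'h)" where
  "scale_operator c T = Blinfun (\<lambda>x. c *\<^sub>C T x)"

lemma scale_operator_apply [simp]: "scale_operator c T x = c *\<^sub>C T x"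
  unfolding scale_operator_def
  by (subst bounded_linear_Blinfun_apply)
    (auto intro!: bounded_linear_compose[OF bounded_linear_scaleC_right] blinfun.bounded_linear_right)

definition adjoint_operator ::
  "('h::complex_hilbert_space \<Rightarrow>\<^sub>L 'h) \<Rightarrow> ('h \<Rightarrow>\<^sub>L 'h)" where
  "adjoint_operator T = (THE S. \<forall>x y. cinner (T x) y = cinner x (blinfun_apply S y))"

text \<open>The adjoint of a bounded complex-linear operator exists, by the Riesz representation theorem.\<close>

lemma riesz_representation_real:
  fixes f :: "'a::{real_inner, complete_space} \<Rightarrow> real"
  assumes "bounded_linear f"
  shows "\<exists>v. \<forall>x. f x = inner v x"
proof -
  interpret f: bounded_linear f by fact
  define Q where "Q x = (norm x)\<^sup>2 / 2 - f x" for x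
  obtain K where K: "\<And>x. norm (f x) \<le> norm x * K"
    using f.bounded by blast
  have lower: "- K\<^sup>2 / 2 \<le> Q x" for x
  proof -
    have "f x \<le> norm x * K"
      using K[of x] by simp
    moreover have "0 \<le> (norm x - K)\<^sup>2"
      by simp
    ultimately show ?thesis
      unfolding Q_def by (simp add: power2_diff)
  qed
  define m where "m = Inf (range Q)"
  have bdd: "bdd_below (range Q)"
    using lower by (auto intro!: bdd_belowI)
  have m_le: "m \<le> Q x" for x
    unfolding m_def using bdd by (auto intro: cInf_lower)
  have "\<exists>x. Q x < m + inverse (real (Suc n))" for n
    using cInf_lessD[of "range Q" "m + inverse (real (Suc n))"] unfolding m_def by auto
  then obtain X where X: "\<And>n. Q (X n) < m + inverse (real (Suc n))"
    by metis
  have parallelogram: "(norm (x - y))\<^sup>2 / 4 = Q x + Q y - 2 * Q ((1/2) *\<^sub>R (x + y))" for x y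
    unfolding Q_def power2_norm_eq_inner
    by (simp add: f.scaleR f.add inner_commute algebra_simps inner_add_left inner_diff_left)
      (simp add: field_simps)
  have dist_X: "(norm (X i - X j))\<^sup>2 \<le> 4 * (inverse (real (Suc i)) + inverse (real (Suc j)))" for i j
  proof -
    have "p \<le> 4 * (r + s)"
      if "p / 4 = q + q' - 2 * q''" "q < m + r" "q' < m + s" "m \<le> q''" for p q q' q'' r s :: real
      using that by argo
    then show ?thesis
      using parallelogram X m_le by blast
  qed
  have "Cauchy X"
  proof (rule CauchyI)
    fix e :: real
    assume "0 < e"
    then obtain N where N: "inverse (real (Suc N)) < e\<^sup>2 / 8"
      using reals_Archimedean[of "e\<^sup>2 / 8"] by auto
    have "norm (X i - X j) < e" if "N \<le> i" "N \<le> j" for i j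
    proof -
      have "inverse (real (Suc i)) \<le> inverse (real (Suc N))"
        "inverse (real (Suc j)) \<le> inverse (real (Suc N))"
        using that by (auto simp: le_imp_inverse_le)
      then have "(norm (X i - X j))\<^sup>2 < e\<^sup>2"
        using dist_X[of i j] N by argo
      then show ?thesis
        using \<open>0 < e\<close> power2_less_imp_less by fastforce
    qed
    then show "\<exists>N. \<forall>i\<ge>N. \<forall>j\<ge>N. norm (X i - X j) < e"
      by blast
  qed
  then obtain v where v: "X \<longlonglongrightarrow> v"
    by (meson Cauchy_convergent convergent_def)
  have "(\<lambda>n. Q (X n)) \<longlonglongrightarrow> Q v"
    unfolding Q_def by (intro tendsto_intros v f.tendsto) auto
  moreover have "(\<lambda>n. m + inverse (real (Suc n))) \<longlonglongrightarrow> m + 0"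
    by (intro tendsto_intros LIMSEQ_inverse_real_of_nat)
  ultimately have "Q v \<le> m + 0"
    by (rule LIMSEQ_le) (use X less_imp_le in blast)
  then have min: "Q v \<le> Q x" for x
    using m_le[of x] by simp
  have "f x = inner v x" for x
  proof (rule ccontr)
    define d where "d = f x - inner v x"
    assume "f x \<noteq> inner v x"
    then have d: "d \<noteq> 0"
      by (simp add: d_def)
    then have "x \<noteq> 0"
      by (auto simp: d_def f.zero)
    then have N: "0 < (norm x)\<^sup>2"
      by simp
    define r where "r = d / (norm x)\<^sup>2"
    have "Q (v + r *\<^sub>R x) = Q v - r * d + r\<^sup>2 * (norm x)\<^sup>2 / 2"
      unfolding Q_def d_def power2_norm_eq_inner
      by (simp add: f.scaleR f.add inner_commute algebra_simps inner_add_left power2_eq_square)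
    moreover have "r * d = d\<^sup>2 / (norm x)\<^sup>2" "r\<^sup>2 * (norm x)\<^sup>2 = d\<^sup>2 / (norm x)\<^sup>2"
      using N by (auto simp: r_def power2_eq_square field_simps)
    moreover have "0 < d\<^sup>2 / (norm x)\<^sup>2"
      using d N by simp
    ultimately show False
      using min[of "v + r *\<^sub>R x"] by linarith
  qed
  then show ?thesis
    by blast
qed

lemma adjoint_operator_exists:
  assumes "T \<in> bounded_operators"
  shows "\<exists>S \<in> bounded_operators. \<forall>x y. cinner (blinfun_apply T x) y = cinner x (blinfun_apply S y)"
proof -
  have lin: "T (c *\<^sub>C x) = c *\<^sub>C T x" for c x
    using assms by (auto simp: bounded_operators_def)
  have "\<exists>v. \<forall>x. inner (T x) y = inner v x" for y
    by (intro riesz_representation_real bounded_linear_intros)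
  then obtain S where S: "\<And>x y. inner (T x) y = inner (S y) x"
    by metis
  have Sc: "cinner (T x) y = cinner x (S y)" for x y
    using S[of x y] S[of "\<i> *\<^sub>C x" y] by (simp add: cinner_eq_inner lin inner_commute)
  have eqI: "u = w" if "\<And>x. cinner x u = cinner x w" for u w :: 'a
  proof -
    have "inner (u - w) u = inner (u - w) w"
      using that by (simp add: inner_eq_Re_cinner)
    then have "inner (u - w) (u - w) = 0"
      by (simp add: inner_diff_right)
    then show ?thesis
      by simp
  qed
  have add_right: "cinner x (y + z) = cinner x y + cinner x z" for x y z :: 'a
    by (metis cinner_add_left cinner_commute complex_cnj_add)
  have scale_right: "cinner x (c *\<^sub>C y) = cnj c * cinner x y" for c and x y :: 'a
    by (metis cinner_scaleC_left cinner_commute complex_cnj_mult)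
  have S_add: "S (x + y) = S x + S y" for x y
    by (rule eqI) (simp add: add_right flip: Sc)
  have S_scale: "S (c *\<^sub>C x) = c *\<^sub>C S x" for c x
    by (rule eqI) (simp add: scale_right flip: Sc)
  have S_norm: "norm (S y) \<le> norm y * norm T" for y
  proof (cases "S y = 0")
    case False
    have "norm (S y) * norm (S y) = inner (T (S y)) y"
      by (simp add: S power2_norm_eq_inner flip: power2_eq_square)
    also have "\<dots> \<le> norm (T (S y)) * norm y"
      by (rule norm_cauchy_schwarz)
    also have "\<dots> \<le> norm T * norm (S y) * norm y"
      by (intro mult_right_mono norm_blinfun) simp
    finally have "norm (S y) * norm (S y) \<le> norm (S y) * (norm y * norm T)"
      by (simp add: mult_ac)
    then show ?thesis
      using False by simp
  qed simp
  have "bounded_linear S"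
  proof (rule bounded_linear_intro)
    show "S (r *\<^sub>R x) = r *\<^sub>R S x" for r x
      using S_scale[of "complex_of_real r"] by (simp add: scaleC_of_real)
  qed (use S_add S_norm in auto)
  then have "blinfun_apply (Blinfun S) = S"
    by (rule bounded_linear_Blinfun_apply)
  then show ?thesis
    using Sc S_scale by (intro bexI[of _ "Blinfun S"]) (auto simp: bounded_operators_def)
qed

lemma adjoint_operator_eqI:
  assumes "\<And>x y. cinner (blinfun_apply T x) y = cinner x (blinfun_apply S y)"
  shows "adjoint_operator T = S"
  unfolding adjoint_operator_def
proof (rule the_equality)
  fix R :: "'a \<Rightarrow>\<^sub>L 'a"
  assume R: "\<forall>x y. cinner (T x) y = cinner x (R y)"
  show "R = S"
  proof (rule blinfun_eqI)
    fix y
    have "inner (R y - S y) (R y) = inner (R y - S y) (S y)"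
      using R assms by (metis inner_eq_Re_cinner)
    then have "inner (R y - S y) (R y - S y) = 0"
      by (simp add: inner_diff_right)
    then show "R y = S y"
      by simp
  qed
qed (use assms in blast)

lemma
  assumes "T \<in> bounded_operators"
  shows adjoint_operator_in: "adjoint_operator T \<in> bounded_operators"
    and cinner_adjoint_operator:
      "cinner (blinfun_apply T x) y = cinner x (blinfun_apply (adjoint_operator T) y)"
  using adjoint_operator_exists[OF assms] adjoint_operator_eqI by metis+


section \<open>Von Neumann algebras\<close>

text \<open>
  A von Neumann algebra is a strongly closed *-subalgebra of \<open>B(H)\<close> containing the identity
  operator of \<open>H\<close>.
\<close>

definition von_neumann_algebra :: "('h::complex_hilbert_space \<Rightarrow>\<^sub>L 'h) set \<Rightarrow> bool" where
  "von_neumann_algebra M \<longleftrightarrow>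
     M \<subseteq> bounded_operators \<and>
     id_blinfun \<in> M \<and>
     (\<forall>S\<in>M. \<forall>T\<in>M. S + T \<in> M) \<and>
     (\<forall>c. \<forall>T\<in>M. scale_operator c T \<in> M) \<and>
     (\<forall>S\<in>M. \<forall>T\<in>M. S o\<^sub>L T \<in> M) \<and>
     (\<forall>T\<in>M. adjoint_operator T \<in> M) \<and>
     closedin strong_operator_topology M"

definition isometry_operator :: "('h::complex_hilbert_space \<Rightarrow>\<^sub>L 'h) \<Rightarrow> bool" where
  "isometry_operator v \<longleftrightarrow> adjoint_operator v o\<^sub>L v = id_blinfun"

definition unitary_operator :: "('h::complex_hilbert_space \<Rightarrow>\<^sub>L 'h) \<Rightarrow> bool" where
  "unitary_operator u \<longleftrightarrow>
     adjoint_operator u o\<^sub>L u = id_blinfun \<and> u o\<^sub>L adjoint_operator u = id_blinfun"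

text \<open>
  The inverse is only required to be a bounded operator; that the inverse of an element of a
  von Neumann algebra lies in the algebra is then a theorem.  The inverse of a complex-linear
  operator is complex-linear.
\<close>

definition invertible_operator :: "('h::complex_hilbert_space \<Rightarrow>\<^sub>L 'h) \<Rightarrow> bool" where
  "invertible_operator t \<longleftrightarrow> (\<exists>s. t o\<^sub>L s = id_blinfun \<and> s o\<^sub>L t = id_blinfun)"

definition inverse_operator ::
  "('h::complex_hilbert_space \<Rightarrow>\<^sub>L 'h) \<Rightarrow> ('h \<Rightarrow>\<^sub>L 'h)" where
  "inverse_operator t = (THE s. t o\<^sub>L s = id_blinfun \<and> s o\<^sub>L t = id_blinfun)"

lemma inverse_operator_eqI:
  assumes "t o\<^sub>L s = id_blinfun" "s o\<^sub>L t = id_blinfun"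
  shows "inverse_operator t = s"
  unfolding inverse_operator_def
proof (rule the_equality)
  fix r
  assume "t o\<^sub>L r = id_blinfun \<and> r o\<^sub>L t = id_blinfun"
  then show "r = s"
    using assms by (metis blinfun_apply_blinfun_compose blinfun_apply_id_blinfun blinfun_eqI)
qed (use assms in blast)

end

theory Submission
  imports Defs
begin

text \<open>
  Put \<open>s = t\<^sup>-\<^sup>1\<close> and \<open>p = 1 - a a\<^sup>*\<close>.  Starting from \<open>S\<^sub>0 = t\<close>, the recursion
  \<open>S\<^sub>n\<^sub>+\<^sub>1 = b S\<^sub>n a\<^sup>* + s\<^sup>* p\<close> satisfies \<open>S\<^sub>n\<^sub>+\<^sub>1 a = b S\<^sub>n\<close> and \<open>b\<^sup>* S\<^sub>n\<^sub>+\<^sub>1 = S\<^sub>n a\<^sup>*\<close>, because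
  \<open>s\<^sup>*\<close> maps the kernel of \<open>a\<^sup>*\<close> into that of \<open>b\<^sup>*\<close>.  The sequence is bounded and converges
  strongly to an operator \<open>S\<close> which acts as \<open>t\<close> on the unitary part of the Wold decomposition of \<open>a\<close>
  and as \<open>\<Sum>k. b\<^sup>k s\<^sup>* p a\<^sup>*\<^sup>k\<close> on the shift part.  Exchanging the roles of \<open>a\<close> and \<open>b\<close> gives the
  inverse of \<open>S\<close>.  Since \<open>b S = S a\<close> and \<open>b\<^sup>* S = S a\<^sup>*\<close>, the unitary polar factor of \<open>S\<close> also
  intertwines \<open>a\<close> and \<open>b\<close>; it is the norm limit of the Newton-Schulz iteration
  \<open>u \<mapsto> u + u (1 - u\<^sup>* u) / 2\<close>, so it belongs to \<open>M\<close>.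
\<close>

instance complex_hilbert_space \<subseteq> banach ..

notation adjoint_operator (\<open>_\<^sup>\<star>\<close> [1000] 1000)

lemmas blinfun_linear_simps =
  blinfun.add_left blinfun.diff_left blinfun.scaleR_left
  blinfun.add_right blinfun.diff_right blinfun.scaleR_right

lemma blinfun_eq_iff: "f = g \<longleftrightarrow> (\<forall>x. blinfun_apply f x = blinfun_apply g x)"
  by (auto intro: blinfun_eqI)

lemma blinfun_compose_apply_eq: "S o\<^sub>L T = U \<Longrightarrow> blinfun_apply S (blinfun_apply T x) = blinfun_apply U x"
  by auto

section \<open>Adjoints and von Neumann algebras\<close>

lemma inner_adjoint_right:
  assumes "T \<in> bounded_operators"
  shows "inner (T x) y = inner x (T\<^sup>\<star> y)"
  using cinner_adjoint_operator[OF assms] by (simp add: inner_eq_Re_cinner)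

lemma inner_adjoint_left:
  assumes "T \<in> bounded_operators"
  shows "inner (T\<^sup>\<star> x) y = inner x (T y)"
  using inner_adjoint_right[OF assms] by (metis inner_commute)

lemma cinner_add_right: "cinner x (y + z) = cinner x y + cinner x z"
  by (metis cinner_add_left cinner_commute complex_cnj_add)

lemma scaleC_scaleR: "c *\<^sub>C (r *\<^sub>R x) = r *\<^sub>R (c *\<^sub>C x)"
  by (simp add: scaleC_scaleC mult.commute flip: scaleC_of_real)

lemma cinner_scaleR_left: "cinner (r *\<^sub>R x) y = of_real r * cinner x y"
  by (metis cinner_scaleC_left scaleC_of_real)

lemma cinner_scaleR_right: "cinner x (r *\<^sub>R y) = of_real r * cinner x y"
  by (metis cinner_scaleR_left cinner_commute complex_cnj_mult complex_cnj_complex_of_real)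

lemma adjoint_adjoint:
  assumes "T \<in> bounded_operators"
  shows "T\<^sup>\<star>\<^sup>\<star> = T"
  by (rule adjoint_operator_eqI) (metis assms cinner_adjoint_operator cinner_commute)

lemma adjoint_id: "id_blinfun\<^sup>\<star> = id_blinfun"
  by (rule adjoint_operator_eqI) simp

lemma adjoint_compose:
  assumes "S \<in> bounded_operators" "T \<in> bounded_operators"
  shows "(S o\<^sub>L T)\<^sup>\<star> = T\<^sup>\<star> o\<^sub>L S\<^sup>\<star>"
  by (rule adjoint_operator_eqI) (simp add: assms cinner_adjoint_operator)

lemma adjoint_add:
  assumes "S \<in> bounded_operators" "T \<in> bounded_operators"
  shows "(S + T)\<^sup>\<star> = S\<^sup>\<star> + T\<^sup>\<star>"
  by (rule adjoint_operator_eqI)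
    (simp add: assms cinner_adjoint_operator blinfun.add_left cinner_add_left cinner_add_right)

lemma adjoint_scaleR:
  assumes "T \<in> bounded_operators"
  shows "(r *\<^sub>R T)\<^sup>\<star> = r *\<^sub>R T\<^sup>\<star>"
  by (rule adjoint_operator_eqI)
    (simp add: assms cinner_adjoint_operator blinfun.scaleR_left cinner_scaleR_left cinner_scaleR_right)

lemma bounded_operators_add:
  "S \<in> bounded_operators \<Longrightarrow> T \<in> bounded_operators \<Longrightarrow> S + T \<in> bounded_operators"
  by (simp add: bounded_operators_def blinfun.add_left scaleC_add_right)

lemma bounded_operators_scaleR: "T \<in> bounded_operators \<Longrightarrow> r *\<^sub>R T \<in> bounded_operators"
  by (simp add: bounded_operators_def blinfun.scaleR_left scaleC_scaleR)

lemma bounded_operators_diff: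
  "S \<in> bounded_operators \<Longrightarrow> T \<in> bounded_operators \<Longrightarrow> S - T \<in> bounded_operators"
  using bounded_operators_add[of S "(- 1) *\<^sub>R T"] bounded_operators_scaleR[of T "- 1"] by simp

lemma bounded_operators_compose:
  "S \<in> bounded_operators \<Longrightarrow> T \<in> bounded_operators \<Longrightarrow> S o\<^sub>L T \<in> bounded_operators"
  by (simp add: bounded_operators_def)

lemma bounded_operators_id: "id_blinfun \<in> bounded_operators"
  by (simp add: bounded_operators_def)

lemma adjoint_diff:
  assumes "S \<in> bounded_operators" "T \<in> bounded_operators"
  shows "(S - T)\<^sup>\<star> = S\<^sup>\<star> - T\<^sup>\<star>"
  using adjoint_add[OF assms(1) bounded_operators_scaleR[OF assms(2), of "- 1"]]
    adjoint_scaleR[OF assms(2), of "- 1"]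
  by simp

lemma bounded_operators_inverse:
  assumes "t \<in> bounded_operators" "t o\<^sub>L s = id_blinfun" "s o\<^sub>L t = id_blinfun"
  shows "s \<in> bounded_operators"
proof -
  have ts: "t (s x) = x" and st: "s (t x) = x" for x
    using assms(2,3)[THEN blinfun_compose_apply_eq] by simp_all
  have "s (c *\<^sub>C x) = c *\<^sub>C s x" for c x
  proof -
    have "s (c *\<^sub>C x) = s (t (c *\<^sub>C s x))"
      using assms(1) by (simp add: bounded_operators_def ts)
    then show ?thesis
      by (simp add: st)
  qed
  then show ?thesis
    by (simp add: bounded_operators_def)
qed

lemma norm_adjoint_le:
  assumes "T \<in> bounded_operators"
  shows "norm (T\<^sup>\<star>) \<le> norm T"
proof (rule norm_blinfun_bound)
  fix y
  have "norm (T\<^sup>\<star> y) * norm (T\<^sup>\<star> y) = inner (T (T\<^sup>\<star> y)) y"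
    by (simp add: inner_adjoint_right[OF assms] flip: power2_eq_square power2_norm_eq_inner)
  also have "\<dots> \<le> norm (T (T\<^sup>\<star> y)) * norm y"
    by (rule norm_cauchy_schwarz)
  also have "\<dots> \<le> norm T * norm (T\<^sup>\<star> y) * norm y"
    by (intro mult_right_mono norm_blinfun) simp
  finally have *: "norm (T\<^sup>\<star> y) * norm (T\<^sup>\<star> y) \<le> norm (T\<^sup>\<star> y) * (norm T * norm y)"
    by (simp add: mult_ac)
  show "norm (T\<^sup>\<star> y) \<le> norm T * norm y"
    using * by (cases "T\<^sup>\<star> y = 0") auto
qed simp

section \<open>Sequential limits in the strong operator topology\<close>

lemma closedin_strong_operator_topology_limit:
  fixes X :: "nat \<Rightarrow> ('a::real_normed_vector \<Rightarrow>\<^sub>L 'b::real_normed_vector)" and L :: "'a \<Rightarrow>\<^sub>L 'b"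
  assumes closed: "closedin strong_operator_topology M"
    and X: "\<And>n. X n \<in> M"
    and lim: "\<And>x. (\<lambda>n. X n x) \<longlonglongrightarrow> L x"
  shows "L \<in> M"
proof (rule ccontr)
  assume "L \<notin> M"
  have "openin strong_operator_topology (- M)"
    using closed by (simp add: closedin_def strong_operator_topology_topspace Compl_eq_Diff_UNIV)
  then obtain U :: "('a \<Rightarrow> 'b) set" where U: "open U" "- M = blinfun_apply -` U"
    unfolding strong_operator_topology_def openin_pullback_topology by auto
  \<comment> \<open>The strong operator topology is the pullback along \<open>blinfun_apply\<close>
    of the product topology on functions, in which convergence is pointwise.\<close>
  have "limitin (product_topology (\<lambda>i. euclidean) UNIV) (\<lambda>n. blinfun_apply (X n)) L sequentially"
    unfolding limitin_componentwise using lim by simp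
  then have "(\<lambda>n. blinfun_apply (X n)) \<longlonglongrightarrow> blinfun_apply L"
    by (simp add: euclidean_product_topology)
  moreover have "blinfun_apply L \<in> U"
    using U(2) \<open>L \<notin> M\<close> by auto
  ultimately have "\<forall>\<^sub>F n in sequentially. blinfun_apply (X n) \<in> U"
    using topological_tendstoD[OF _ U(1)] by blast
  then obtain n where "blinfun_apply (X n) \<in> U"
    by (auto simp: eventually_sequentially)
  then show False
    using U(2) X[of n] by auto
qed

lemma bounded_pointwise_limit_blinfun:
  fixes X :: "nat \<Rightarrow> ('a::real_normed_vector \<Rightarrow>\<^sub>L 'b::real_normed_vector)"
  assumes bound: "\<And>n x. norm (X n x) \<le> C * norm x"
    and conv: "\<And>x. convergent (\<lambda>n. X n x)"
  obtains L :: "'a \<Rightarrow>\<^sub>L 'b" where "\<And>x. (\<lambda>n. X n x) \<longlonglongrightarrow> L x"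
proof -
  obtain L where L: "\<And>x. (\<lambda>n. X n x) \<longlonglongrightarrow> L x"
    using conv unfolding convergent_def by metis
  have "bounded_linear L"
  proof (rule bounded_linear_intro[where K = C])
    show "L (x + y) = L x + L y" for x y
      using LIMSEQ_unique[OF L[of "x + y"]] tendsto_add[OF L[of x] L[of y]]
      by (simp add: blinfun.add_right)
    show "L (r *\<^sub>R x) = r *\<^sub>R L x" for r x
      using LIMSEQ_unique[OF L[of "r *\<^sub>R x"]] tendsto_scaleR[OF tendsto_const L[of x], of r]
      by (simp add: blinfun.scaleR_right)
    show "norm (L x) \<le> norm x * C" for x
      using LIMSEQ_le_const2[OF tendsto_norm[OF L[of x]]] bound[of _ x] by (auto simp: mult.commute)
  qed
  then show thesis
    using L that[of "Blinfun L"] by (simp add: bounded_linear_Blinfun_apply)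
qed

section \<open>Membership in a von Neumann algebra\<close>

context
  fixes M :: "('h::complex_hilbert_space \<Rightarrow>\<^sub>L 'h) set"
  assumes M: "von_neumann_algebra M"
begin

lemma vn_bounded: "T \<in> M \<Longrightarrow> T \<in> bounded_operators"
  and vn_id: "id_blinfun \<in> M"
  and vn_add: "S \<in> M \<Longrightarrow> T \<in> M \<Longrightarrow> S + T \<in> M"
  and vn_compose: "S \<in> M \<Longrightarrow> T \<in> M \<Longrightarrow> S o\<^sub>L T \<in> M"
  and vn_adjoint: "T \<in> M \<Longrightarrow> T\<^sup>\<star> \<in> M"
  using M by (auto simp: von_neumann_algebra_def)

lemma vn_scaleR:
  assumes "T \<in> M"
  shows "r *\<^sub>R T \<in> M"
proof -
  have "r *\<^sub>R T = scale_operator (complex_of_real r) T"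
    by (rule blinfun_eqI) (simp add: blinfun.scaleR_left scaleC_of_real)
  then show ?thesis
    using M assms by (auto simp: von_neumann_algebra_def)
qed

lemma vn_diff: "S \<in> M \<Longrightarrow> T \<in> M \<Longrightarrow> S - T \<in> M"
  using vn_add[of S "(- 1) *\<^sub>R T"] vn_scaleR[of T "- 1"] by simp

lemma vn_strong_limit:
  assumes "\<And>n. X n \<in> M" "\<And>x. (\<lambda>n. blinfun_apply (X n) x) \<longlonglongrightarrow> blinfun_apply L x"
  shows "L \<in> M"
  using closedin_strong_operator_topology_limit[of M X L] M assms
  by (auto simp: von_neumann_algebra_def)

lemma vn_norm_limit:
  assumes "\<And>n. X n \<in> M" "X \<longlonglongrightarrow> L"
  shows "L \<in> M"
  using assms(1) by (rule vn_strong_limit) (auto intro!: tendsto_intros assms(2))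

end

section \<open>Inverses and polar factors\<close>

text \<open>The left inverse bounds \<open>T\<close> from below:
  \<open>norm x \<le> C * norm (T x)\<close>. Expanding the square of
  \<open>norm (x - T\<^sup>\<star> (T x))\<close> and using that \<open>T\<^sup>\<star>\<close> is a
  contraction leaves at most \<open>(norm x)\<^sup>2 - (norm (T x))\<^sup>2\<close>.\<close>

lemma norm_defect_le:
  assumes T: "T \<in> bounded_operators" "norm T \<le> 1"
    and R: "R o\<^sub>L T = id_blinfun" "norm R \<le> C" and C: "1 \<le> C"
  shows "norm (id_blinfun - (T\<^sup>\<star> o\<^sub>L T)) \<le> sqrt (1 - 1 / C\<^sup>2)"
proof (rule norm_blinfun_bound)
  have C2: "1 / C\<^sup>2 \<le> 1"
    using C by (simp add: field_simps)
  then show "0 \<le> sqrt (1 - 1 / C\<^sup>2)"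
    by simp
  fix x
  define y where "y = T x"
  have "norm x = norm (R y)"
    unfolding y_def using blinfun_compose_apply_eq[OF R(1)] by simp
  also have "\<dots> \<le> C * norm y"
    using norm_blinfun[of R y] mult_right_mono[OF R(2), of "norm y"] by simp
  finally have "(norm x)\<^sup>2 \<le> C\<^sup>2 * (norm y)\<^sup>2"
    by (metis norm_ge_zero power_mono power_mult_distrib)
  then have low: "(norm x)\<^sup>2 / C\<^sup>2 \<le> (norm y)\<^sup>2"
    using C by (simp add: field_simps)
  have "norm (T\<^sup>\<star> y) \<le> 1 * norm y"
    using norm_blinfun[of "T\<^sup>\<star>" y] norm_adjoint_le[OF T(1)] T(2)
    by (meson mult_right_mono norm_ge_zero order_trans)
  then have up: "(norm (T\<^sup>\<star> y))\<^sup>2 \<le> (norm y)\<^sup>2"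
    by simp
  have "(norm (x - T\<^sup>\<star> y))\<^sup>2 = (norm x)\<^sup>2 - 2 * (norm y)\<^sup>2 + (norm (T\<^sup>\<star> y))\<^sup>2"
    using inner_adjoint_left[OF T(1), of y x] inner_commute[of x "T\<^sup>\<star> y"]
    unfolding power2_norm_eq_inner by (simp add: inner_diff y_def)
  also have "\<dots> \<le> (1 - 1 / C\<^sup>2) * (norm x)\<^sup>2"
    using add_mono[OF low up] by (simp add: left_diff_distrib)
  also have "\<dots> = (sqrt (1 - 1 / C\<^sup>2) * norm x)\<^sup>2"
    using C2 by (simp add: power_mult_distrib)
  finally have "norm (x - T\<^sup>\<star> y) \<le> sqrt (1 - 1 / C\<^sup>2) * norm x"
    by (rule power2_le_imp_le) (use C2 in simp)
  then show "norm ((id_blinfun - (T\<^sup>\<star> o\<^sub>L T)) x) \<le> sqrt (1 - 1 / C\<^sup>2) * norm x"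
    by (simp add: blinfun.diff_left y_def)
qed

text \<open>The scaling by \<open>k\<close> makes \<open>S\<close> a contraction.\<close>

lemma invertible_scaled_defects:
  assumes S: "S \<in> bounded_operators" and R: "R \<in> bounded_operators"
    and SR: "S o\<^sub>L R = id_blinfun" and RS: "R o\<^sub>L S = id_blinfun"
  obtains k \<rho> :: real where "0 < k" "0 \<le> \<rho>" "\<rho> < 1"
    "norm (id_blinfun - ((k *\<^sub>R S)\<^sup>\<star> o\<^sub>L (k *\<^sub>R S))) \<le> \<rho>"
    "norm (id_blinfun - ((k *\<^sub>R S) o\<^sub>L (k *\<^sub>R S)\<^sup>\<star>)) \<le> \<rho>"
proof -
  \<comment> \<open>Adding 1 keeps the divisor positive even on the zero space, where
    \<open>S = 0\<close> is invertible; in \<open>C\<close> it secures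
    \<open>1 \<le> C\<close>.\<close>
  define N where "N = norm S + 1"
  define T where "T = (1 / N) *\<^sub>R S"
  define Q where "Q = N *\<^sub>R R"
  define C where "C = norm Q + 1"
  have N: "0 < N"
    by (simp add: N_def add_nonneg_pos)
  have T: "T \<in> bounded_operators" and Q: "Q \<in> bounded_operators"
    unfolding T_def Q_def by (intro bounded_operators_scaleR S R)+
  have "norm T \<le> 1"
    using N by (simp add: T_def N_def field_simps)
  have TQ: "T o\<^sub>L Q = id_blinfun" and QT: "Q o\<^sub>L T = id_blinfun"
    using N SR RS unfolding T_def Q_def blinfun_eq_iff
    by (simp_all add: blinfun_linear_simps)
  \<comment> \<open>The other defect is bounded by the same estimate applied to
    \<open>T\<^sup>\<star>\<close>, whose left inverse is \<open>Q\<^sup>\<star>\<close>.\<close>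
  have "Q\<^sup>\<star> o\<^sub>L T\<^sup>\<star> = id_blinfun"
    using adjoint_compose[OF T Q] TQ by (simp add: adjoint_id)
  moreover have "norm (T\<^sup>\<star>) \<le> 1" "norm (Q\<^sup>\<star>) \<le> C"
    using norm_adjoint_le[OF T] norm_adjoint_le[OF Q] \<open>norm T \<le> 1\<close> by (auto simp: C_def)
  ultimately have "norm (id_blinfun - (T\<^sup>\<star>\<^sup>\<star> o\<^sub>L T\<^sup>\<star>)) \<le> sqrt (1 - 1 / C\<^sup>2)"
    by (intro norm_defect_le adjoint_operator_in T) (auto simp: C_def)
  moreover have "norm (id_blinfun - (T\<^sup>\<star> o\<^sub>L T)) \<le> sqrt (1 - 1 / C\<^sup>2)"
    using T \<open>norm T \<le> 1\<close> QT by (rule norm_defect_le) (auto simp: C_def)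
  moreover have "1 \<le> C"
    by (simp add: C_def)
  then have "0 \<le> sqrt (1 - 1 / C\<^sup>2)" "sqrt (1 - 1 / C\<^sup>2) < 1"
    by (auto simp: field_simps)
  ultimately show thesis
    using that[of "1 / N" "sqrt (1 - 1 / C\<^sup>2)"] N by (simp add: T_def[symmetric] adjoint_adjoint[OF T])
qed

text \<open>After scaling, \<open>T T\<^sup>\<star>\<close> is within \<open>\<rho> < 1\<close> of
  the identity. The iterates \<open>y n\<close> are \<open>T\<^sup>\<star>\<close> times partial
  sums of the Neumann series in \<open>E = 1 - T T\<^sup>\<star>\<close>; they stay in
  \<open>M\<close> and converge in norm to the inverse of \<open>T\<close>.\<close>

lemma vn_inverse:
  assumes M: "von_neumann_algebra M" and t: "t \<in> M"
    and ts: "t o\<^sub>L s = id_blinfun" and st: "s o\<^sub>L t = id_blinfun"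
  shows "s \<in> M"
proof -
  note tB = vn_bounded[OF M t]
  obtain k \<rho> :: real where k: "0 < k" and \<rho>: "0 \<le> \<rho>" "\<rho> < 1"
    and defect: "norm (id_blinfun - ((k *\<^sub>R t) o\<^sub>L (k *\<^sub>R t)\<^sup>\<star>)) \<le> \<rho>"
    using invertible_scaled_defects[OF tB bounded_operators_inverse[OF tB ts st] ts st] by metis
  define T where "T = k *\<^sub>R t"
  define S where "S = (1 / k) *\<^sub>R s"
  have T: "T \<in> M"
    unfolding T_def by (rule vn_scaleR[OF M t])
  have ST: "S (T x) = x" for x
    using k arg_cong[OF st, of "\<lambda>f. blinfun_apply f x"]
    by (simp add: S_def T_def blinfun_linear_simps)
  define E where "E = id_blinfun - (T o\<^sub>L T\<^sup>\<star>)"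
  define y where "y = rec_nat 0 (\<lambda>_ Y. Y + (T\<^sup>\<star> o\<^sub>L (id_blinfun - (T o\<^sub>L Y))))"
  have y0: "y 0 = 0" and ySuc: "y (Suc n) = y n + (T\<^sup>\<star> o\<^sub>L (id_blinfun - (T o\<^sub>L y n)))" for n
    by (simp_all add: y_def)
  have "y n \<in> M" for n
  proof (induction n)
    case 0
    have "(0 :: 'a \<Rightarrow>\<^sub>L 'a) = 0 *\<^sub>R T"
      by simp
    then show ?case
      unfolding y0 by (metis vn_scaleR[OF M T])
  next
    case (Suc n)
    then show ?case
      unfolding ySuc by (intro vn_add vn_compose vn_diff vn_adjoint vn_id M T)
  qed
  moreover have "y \<longlonglongrightarrow> S"
  proof -
    \<comment> \<open>Starting at \<open>y 0 = 0\<close>, the residual is initially the identity,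
      and each step multiplies it by \<open>E\<close>.\<close>
    have "norm (id_blinfun - (T o\<^sub>L y n)) \<le> \<rho> ^ n" for n
    proof (induction n)
      case 0
      show ?case
        by (auto simp: y0 intro!: norm_blinfun_bound)
    next
      case (Suc n)
      have "id_blinfun - (T o\<^sub>L y (Suc n)) = E o\<^sub>L (id_blinfun - (T o\<^sub>L y n))"
        by (rule blinfun_eqI) (simp add: ySuc E_def blinfun_linear_simps)
      then have "norm (id_blinfun - (T o\<^sub>L y (Suc n))) \<le> norm E * norm (id_blinfun - (T o\<^sub>L y n))"
        by (simp add: norm_blinfun_compose)
      also have "\<dots> \<le> \<rho> * \<rho> ^ n"
        using Suc defect \<rho> by (intro mult_mono) (auto simp: E_def T_def)
      finally show ?case
        by simp
    qed
    moreover have "(\<lambda>n. \<rho> ^ n) \<longlonglongrightarrow> 0"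
      using \<rho> by (intro LIMSEQ_realpow_zero) auto
    ultimately have "(\<lambda>n. id_blinfun - (T o\<^sub>L y n)) \<longlonglongrightarrow> 0"
      by (rule Lim_null_comparison[OF always_eventually[OF allI]])
    then have "(\<lambda>n. S - (S o\<^sub>L (id_blinfun - (T o\<^sub>L y n)))) \<longlonglongrightarrow> S - (S o\<^sub>L 0)"
      by (intro tendsto_intros)
    moreover have "S - (S o\<^sub>L (id_blinfun - (T o\<^sub>L y n))) = y n" for n
      by (rule blinfun_eqI) (simp add: blinfun_linear_simps ST)
    ultimately show ?thesis
      by simp
  qed
  ultimately have "S \<in> M"
    by (rule vn_norm_limit[OF M])
  then have "k *\<^sub>R S \<in> M"
    by (rule vn_scaleR[OF M])
  then show ?thesis
    using k by (simp add: S_def)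
qed

section \<open>Newton-Schulz iteration for the unitary polar factor\<close>

definition polar_step :: "('h::complex_hilbert_space \<Rightarrow>\<^sub>L 'h) \<Rightarrow> ('h \<Rightarrow>\<^sub>L 'h)" where
  "polar_step T = T + (1/2) *\<^sub>R (T o\<^sub>L (id_blinfun - (T\<^sup>\<star> o\<^sub>L T)))"

text \<open>This rests on \<open>(1 - T\<^sup>\<star> T) T\<^sup>\<star> = T\<^sup>\<star> (1 - T
  T\<^sup>\<star>)\<close>. It lets estimates for \<open>T\<^sup>\<star> T\<close> be transferred to
  \<open>T T\<^sup>\<star>\<close>.\<close>

lemma adjoint_polar_step:
  assumes "T \<in> bounded_operators"
  shows "(polar_step T)\<^sup>\<star> = polar_step (T\<^sup>\<star>)"
  unfolding polar_step_def
  apply (simp add: adjoint_add adjoint_scaleR adjoint_diff adjoint_compose adjoint_adjoint adjoint_id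
      bounded_operators_scaleR bounded_operators_compose bounded_operators_diff bounded_operators_id
      adjoint_operator_in assms)
  by (rule blinfun_eqI) (simp add: blinfun_linear_simps)

text \<open>With \<open>E = 1 - T\<^sup>\<star> T\<close> the step is \<open>T (1 + E / 2)\<close>,
  so the new defect is \<open>1 - (1 + E / 2) (1 - E) (1 + E / 2) = (3 E\<^sup>2 + E\<^sup>3) /
  4\<close>. A geometric rate is enough: \<open>e\<close> bounds the current defect and
  \<open>\<rho>\<close> serves as a fixed ratio.\<close>

lemma norm_polar_step_defect:
  assumes T: "T \<in> bounded_operators"
    and e: "norm (id_blinfun - (T\<^sup>\<star> o\<^sub>L T)) \<le> e" "e \<le> \<rho>" and \<rho>: "\<rho> \<le> 1"
  shows "norm (id_blinfun - ((polar_step T)\<^sup>\<star> o\<^sub>L polar_step T)) \<le> e * \<rho>"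
proof -
  define E where "E = id_blinfun - (T\<^sup>\<star> o\<^sub>L T)"
  have TT: "T\<^sup>\<star> (T x) = x - E x" for x
    by (simp add: E_def blinfun_linear_simps)
  have adj: "(polar_step T)\<^sup>\<star> y = T\<^sup>\<star> y + (1/2) *\<^sub>R E (T\<^sup>\<star> y)" for y
    unfolding adjoint_polar_step[OF T]
    by (simp add: polar_step_def E_def adjoint_adjoint[OF T] blinfun_linear_simps)
  have step: "polar_step T x = T (x + (1/2) *\<^sub>R E x)" for x
    by (simp add: polar_step_def E_def blinfun_linear_simps)
  have "id_blinfun - ((polar_step T)\<^sup>\<star> o\<^sub>L polar_step T) = E o\<^sub>L ((3/4) *\<^sub>R E + (1/4) *\<^sub>R (E o\<^sub>L E))"
    (is "?L = E o\<^sub>L ?G")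
  proof (rule blinfun_eqI)
    fix x
    \<comment> \<open>Pairing with an arbitrary \<open>z\<close> reduces the vector identity to one
      between real numbers.\<close>
    have "inner (?L x) z = inner ((E o\<^sub>L ?G) x) z" for z
      unfolding blinfun.diff_left blinfun_apply_blinfun_compose adj step TT
      by (simp add: blinfun_linear_simps inner_add_left inner_diff_left field_simps)
    then show "?L x = (E o\<^sub>L ?G) x"
      using vector_eq_rdot by blast
  qed
  then have "norm ?L \<le> norm E * norm ?G"
    by (simp add: norm_blinfun_compose)
  also have "\<dots> \<le> e * \<rho>"
  proof (rule mult_mono)
    have E: "norm E \<le> e" "norm E \<le> \<rho>"
      using e by (auto simp: E_def)
    have "norm (E o\<^sub>L E) \<le> norm E * norm E"
      by (rule norm_blinfun_compose)
    also have "\<dots> \<le> \<rho> * 1"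
      using E \<rho> by (intro mult_mono) (auto intro: order_trans[OF norm_ge_zero])
    finally have "norm (E o\<^sub>L E) \<le> \<rho>"
      by simp
    then show "norm ?G \<le> \<rho>"
      using norm_triangle_ineq[of "(3/4) *\<^sub>R E" "(1/4) *\<^sub>R (E o\<^sub>L E)"] E by simp
    show "norm E \<le> e" "0 \<le> e"
      using E by (auto intro: order_trans[OF norm_ge_zero])
  qed simp
  finally show ?thesis .
qed

text \<open>Follows from \<open>(norm (T x))\<^sup>2 = inner x (x - E x)\<close>. The crude constant
  gives the uniform bound that turns defect estimates into estimates of successive
  differences.\<close>

lemma norm_le_2_of_defect:
  assumes T: "T \<in> bounded_operators" and e: "norm (id_blinfun - (T\<^sup>\<star> o\<^sub>L T)) \<le> 1"
  shows "norm T \<le> 2"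
proof (rule norm_blinfun_bound)
  fix x
  define E where "E = id_blinfun - (T\<^sup>\<star> o\<^sub>L T)"
  have "(norm (T x))\<^sup>2 = inner x (x - E x)"
    by (simp add: power2_norm_eq_inner inner_adjoint_right[OF T] E_def blinfun_linear_simps)
  also have "\<dots> \<le> norm x * norm (x - E x)"
    by (rule norm_cauchy_schwarz)
  also have "\<dots> \<le> norm x * (norm x + norm x)"
  proof (intro mult_left_mono)
    have "norm (E x) \<le> 1 * norm x"
      using e norm_blinfun[of E x] unfolding E_def by (meson mult_right_mono norm_ge_zero order_trans)
    then show "norm (x - E x) \<le> norm x + norm x"
      using norm_triangle_ineq4[of x "E x"] by simp
  qed simp
  also have "\<dots> \<le> (2 * norm x)\<^sup>2"
    by (simp add: power2_eq_square)
  finally show "norm (T x) \<le> 2 * norm x"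
    by (rule power2_le_imp_le) simp
qed simp

text \<open>The relations for \<open>b\<close> and \<open>b\<^sup>\<star>\<close> together make
  \<open>S\<^sup>\<star> S\<close> commute with \<open>a\<close>, so the iteration preserves both of
  them. Because both defects tend to 0, the norm limit is unitary and not merely isometric.\<close>

lemma unitary_intertwiner_of_invertible:
  assumes M: "von_neumann_algebra M" and a: "a \<in> M" and b: "b \<in> M" and S: "S \<in> M"
    and R: "R \<in> M" "S o\<^sub>L R = id_blinfun" "R o\<^sub>L S = id_blinfun"
    and bS: "b o\<^sub>L S = S o\<^sub>L a" and bS': "b\<^sup>\<star> o\<^sub>L S = S o\<^sub>L a\<^sup>\<star>"
  shows "\<exists>u\<in>M. unitary_operator u \<and> b o\<^sub>L u = u o\<^sub>L a"
proof -
  note B = vn_bounded[OF M]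
  obtain k \<rho> :: real where k: "0 < k" and \<rho>: "0 \<le> \<rho>" "\<rho> < 1"
    and defect: "norm (id_blinfun - ((k *\<^sub>R S)\<^sup>\<star> o\<^sub>L (k *\<^sub>R S))) \<le> \<rho>"
      "norm (id_blinfun - ((k *\<^sub>R S) o\<^sub>L (k *\<^sub>R S)\<^sup>\<star>)) \<le> \<rho>"
    using invertible_scaled_defects[OF B[OF S] B[OF R(1)] R(2,3)] by metis
  define T where "T n = (polar_step ^^ n) (k *\<^sub>R S)" for n
  have T0: "T 0 = k *\<^sub>R S" and TSuc: "T (Suc n) = polar_step (T n)" for n
    by (simp_all add: T_def)
  have TM: "T n \<in> M" for n
    by (induction n)
      (auto simp: T0 TSuc polar_step_def intro!: vn_add vn_compose vn_diff vn_adjoint vn_id vn_scaleR M S)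
  note TB = B[OF TM]
  \<comment> \<open>The exponent is \<open>Suc n\<close> because the initial defects are already at
    most \<open>\<rho>\<close>. For \<open>T n o\<^sub>L (T n)\<^sup>\<star>\<close> the step
    estimate is applied to the adjoint.\<close>
  have e: "norm (id_blinfun - ((T n)\<^sup>\<star> o\<^sub>L T n)) \<le> \<rho> ^ Suc n
         \<and> norm (id_blinfun - (T n o\<^sub>L (T n)\<^sup>\<star>)) \<le> \<rho> ^ Suc n" for n
  proof (induction n)
    case 0
    then show ?case
      using defect by (simp add: T0)
  next
    case (Suc n)
    have le: "\<rho> ^ Suc n \<le> \<rho>"
      using \<rho> by (simp add: mult_left_le power_le_one)
    have "norm (id_blinfun - ((T (Suc n))\<^sup>\<star> o\<^sub>L T (Suc n))) \<le> \<rho> ^ Suc n * \<rho>"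
      unfolding TSuc using Suc \<rho> le by (intro norm_polar_step_defect TB) auto
    moreover have "norm (id_blinfun - ((polar_step ((T n)\<^sup>\<star>))\<^sup>\<star> o\<^sub>L polar_step ((T n)\<^sup>\<star>))) \<le> \<rho> ^ Suc n * \<rho>"
      using Suc \<rho> le by (intro norm_polar_step_defect adjoint_operator_in TB) (auto simp: adjoint_adjoint[OF TB])
    then have "norm (id_blinfun - (T (Suc n) o\<^sub>L (T (Suc n))\<^sup>\<star>)) \<le> \<rho> ^ Suc n * \<rho>"
      by (simp add: TSuc adjoint_polar_step TB adjoint_adjoint adjoint_operator_in)
    ultimately show ?case
      by (simp add: mult.commute)
  qed
  \<comment> \<open>The factor 1/2 in \<open>polar_step\<close> cancels the bound 2 on
    \<open>norm (T n)\<close>.\<close>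
  have "norm (T (Suc n) - T n) \<le> \<rho> ^ Suc n" for n
  proof -
    have "\<rho> ^ Suc n \<le> 1"
      using \<rho> by (intro power_le_one) auto
    then have "norm (T n) \<le> 2"
      using e[of n] by (intro norm_le_2_of_defect TB) auto
    have "norm (T n o\<^sub>L (id_blinfun - ((T n)\<^sup>\<star> o\<^sub>L T n))) \<le> norm (T n) * norm (id_blinfun - ((T n)\<^sup>\<star> o\<^sub>L T n))"
      by (rule norm_blinfun_compose)
    also have "\<dots> \<le> 2 * \<rho> ^ Suc n"
      using e[of n] \<open>norm (T n) \<le> 2\<close> by (intro mult_mono) auto
    finally show ?thesis
      by (simp add: TSuc polar_step_def)
  qed
  moreover have "summable (\<lambda>n. \<rho> ^ Suc n)"
    using \<rho> by (subst summable_Suc_iff) (auto intro: summable_geometric)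
  ultimately have "summable (\<lambda>n. T (Suc n) - T n)"
    by (rule summable_comparison_test'[rotated])
  then have "convergent (\<lambda>n. T n - T 0)"
    unfolding summable_iff_convergent sum_lessThan_telescope .
  then have "convergent (\<lambda>n. T n - T 0 + T 0)"
    by (intro convergent_add convergent_const)
  then obtain u where u: "T \<longlonglongrightarrow> u"
    by (auto simp: convergent_def)
  have uM: "u \<in> M"
    using TM u by (rule vn_norm_limit[OF M])
  note uB = B[OF uM]
  have u': "(\<lambda>n. (T n)\<^sup>\<star>) \<longlonglongrightarrow> u\<^sup>\<star>"
  proof -
    have "norm ((T n)\<^sup>\<star> - u\<^sup>\<star>) \<le> norm (T n - u)" for n
      using norm_adjoint_le[OF bounded_operators_diff[OF TB uB]] by (simp add: adjoint_diff TB uB)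
    moreover have "(\<lambda>n. norm (T n - u)) \<longlonglongrightarrow> 0"
      using u by (simp add: tendsto_norm_zero LIM_zero)
    ultimately have "(\<lambda>n. (T n)\<^sup>\<star> - u\<^sup>\<star>) \<longlonglongrightarrow> 0"
      by (rule Lim_null_comparison[OF always_eventually[OF allI]])
    then show ?thesis
      by (rule LIM_zero_cancel)
  qed
  have \<rho>0: "(\<lambda>n. \<rho> ^ Suc n) \<longlonglongrightarrow> 0"
    using \<rho> by (intro LIMSEQ_Suc LIMSEQ_realpow_zero) auto
  have "(\<lambda>n. id_blinfun - ((T n)\<^sup>\<star> o\<^sub>L T n)) \<longlonglongrightarrow> id_blinfun - (u\<^sup>\<star> o\<^sub>L u)"
    by (intro tendsto_intros u u')
  moreover have "(\<lambda>n. id_blinfun - ((T n)\<^sup>\<star> o\<^sub>L T n)) \<longlonglongrightarrow> 0"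
    using e by (intro Lim_null_comparison[OF always_eventually[OF allI] \<rho>0]) auto
  ultimately have uu: "id_blinfun - (u\<^sup>\<star> o\<^sub>L u) = 0"
    by (rule LIMSEQ_unique)
  have "(\<lambda>n. id_blinfun - (T n o\<^sub>L (T n)\<^sup>\<star>)) \<longlonglongrightarrow> id_blinfun - (u o\<^sub>L u\<^sup>\<star>)"
    by (intro tendsto_intros u u')
  moreover have "(\<lambda>n. id_blinfun - (T n o\<^sub>L (T n)\<^sup>\<star>)) \<longlonglongrightarrow> 0"
    using e by (intro Lim_null_comparison[OF always_eventually[OF allI] \<rho>0]) auto
  ultimately have "id_blinfun - (u o\<^sub>L u\<^sup>\<star>) = 0"
    by (rule LIMSEQ_unique)
  then have "unitary_operator u"
    using uu by (simp add: unitary_operator_def)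
  have comm: "b o\<^sub>L T n = T n o\<^sub>L a \<and> b\<^sup>\<star> o\<^sub>L T n = T n o\<^sub>L a\<^sup>\<star>" for n
  proof (induction n)
    case 0
    have "b (S x) = S (a x)" "b\<^sup>\<star> (S x) = S (a\<^sup>\<star> x)" for x
      using blinfun_compose_apply_eq[OF bS] blinfun_compose_apply_eq[OF bS'] by simp_all
    then show ?case
      by (auto intro!: blinfun_eqI simp: T0 blinfun_linear_simps)
  next
    case (Suc n)
    then have c: "b (T n x) = T n (a x)" "b\<^sup>\<star> (T n x) = T n (a\<^sup>\<star> x)" for x
      by (auto dest: blinfun_compose_apply_eq)
    \<comment> \<open>Adjoints of the two relations show that \<open>(T n)\<^sup>\<star>\<close>
      intertwines in the reverse direction, which carries them past
      \<open>(T n)\<^sup>\<star> o\<^sub>L T n\<close>.\<close>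
    have "(T n)\<^sup>\<star> o\<^sub>L b\<^sup>\<star> = a\<^sup>\<star> o\<^sub>L (T n)\<^sup>\<star>" "(T n)\<^sup>\<star> o\<^sub>L b = a o\<^sub>L (T n)\<^sup>\<star>"
      using arg_cong[OF conjunct1[OF Suc], of adjoint_operator]
        arg_cong[OF conjunct2[OF Suc], of adjoint_operator]
      by (simp_all add: adjoint_compose TB B[OF a] B[OF b] adjoint_operator_in adjoint_adjoint)
    from this[THEN blinfun_compose_apply_eq] have c': "a\<^sup>\<star> ((T n)\<^sup>\<star> x) = (T n)\<^sup>\<star> (b\<^sup>\<star> x)" "a ((T n)\<^sup>\<star> x) = (T n)\<^sup>\<star> (b x)" for x
      by simp_all
    show ?case
      by (auto intro!: blinfun_eqI simp: TSuc polar_step_def blinfun_linear_simps c c')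
  qed
  have "(\<lambda>n. b o\<^sub>L T n) \<longlonglongrightarrow> (b o\<^sub>L u)" "(\<lambda>n. T n o\<^sub>L a) \<longlonglongrightarrow> (u o\<^sub>L a)"
    by (intro tendsto_intros u)+
  then have "b o\<^sub>L u = u o\<^sub>L a"
    using comm by (simp add: LIMSEQ_unique)
  then show ?thesis
    using uM \<open>unitary_operator u\<close> by blast
qed

section \<open>Similar isometries\<close>

text \<open>Unrolled, the \<open>n\<close>-th term is \<open>b^n t (a\<^sup>\<star>)^n\<close> plus
  the sum over \<open>k < n\<close> of \<open>b^k s\<^sup>\<star> (1 - a a\<^sup>\<star>)
  (a\<^sup>\<star>)^k\<close>. When \<open>b t = t a\<close>, the first summand equals
  \<open>t a^n (a\<^sup>\<star>)^n\<close>, that is, \<open>t\<close> after the projection onto the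
  range of \<open>a^n\<close>.\<close>

primrec reducing_approx ::
  "('h::complex_hilbert_space \<Rightarrow>\<^sub>L 'h) \<Rightarrow> ('h \<Rightarrow>\<^sub>L 'h) \<Rightarrow> ('h \<Rightarrow>\<^sub>L 'h) \<Rightarrow> ('h \<Rightarrow>\<^sub>L 'h) \<Rightarrow> nat \<Rightarrow> ('h \<Rightarrow>\<^sub>L 'h)" where
  "reducing_approx a b t s 0 = t"
| "reducing_approx a b t s (Suc n) =
     (b o\<^sub>L reducing_approx a b t s n o\<^sub>L a\<^sup>\<star>) + (s\<^sup>\<star> o\<^sub>L (id_blinfun - (a o\<^sub>L a\<^sup>\<star>)))"

text \<open>With the inverse \<open>s\<close> as a parameter, the hypotheses are stable under
  exchanging \<open>a\<close> with \<open>b\<close> and \<open>t\<close> with \<open>s\<close>, so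
  each result also holds for the exchanged recursion.\<close>

locale similar_isometries =
  fixes M :: "('h::complex_hilbert_space \<Rightarrow>\<^sub>L 'h) set" and a b t s :: "'h \<Rightarrow>\<^sub>L 'h"
  assumes M: "von_neumann_algebra M"
    and a: "a \<in> M" "isometry_operator a" and b: "b \<in> M" "isometry_operator b"
    and t: "t \<in> M" and s: "s \<in> M"
    and ts: "t o\<^sub>L s = id_blinfun" and st: "s o\<^sub>L t = id_blinfun"
    and bt: "b o\<^sub>L t = t o\<^sub>L a"
begin

abbreviation "S \<equiv> reducing_approx a b t s"

lemmas in_B [simp] = vn_bounded[OF M a(1)] vn_bounded[OF M b(1)] vn_bounded[OF M t] vn_bounded[OF M s]

lemma point_simps [simp]:
  "a\<^sup>\<star> (a x) = x" "b\<^sup>\<star> (b x) = x" "s (t x) = x" "t (s x) = x"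
  by (simp_all add: blinfun_compose_apply_eq[OF a(2)[unfolded isometry_operator_def]]
      blinfun_compose_apply_eq[OF b(2)[unfolded isometry_operator_def]]
      blinfun_compose_apply_eq[OF st] blinfun_compose_apply_eq[OF ts])

lemma b_t: "b (t x) = t (a x)"
  using blinfun_compose_apply_eq[OF bt] by simp

lemma adjoint_t_s [simp]: "t\<^sup>\<star> (s\<^sup>\<star> x) = x" and adjoint_s_t [simp]: "s\<^sup>\<star> (t\<^sup>\<star> x) = x"
proof -
  have "t\<^sup>\<star> o\<^sub>L s\<^sup>\<star> = id_blinfun" "s\<^sup>\<star> o\<^sub>L t\<^sup>\<star> = id_blinfun"
    using adjoint_compose[of s t] adjoint_compose[of t s] by (simp_all add: st ts adjoint_id)
  from this[THEN blinfun_compose_apply_eq] show "t\<^sup>\<star> (s\<^sup>\<star> x) = x" "s\<^sup>\<star> (t\<^sup>\<star> x) = x"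
    by simp_all
qed

text \<open>The adjoint of \<open>b t = t a\<close>, multiplied by \<open>s\<^sup>\<star>\<close> on
  both sides. Hence \<open>s\<^sup>\<star>\<close> maps the kernel of \<open>a\<^sup>\<star>\<close>
  into that of \<open>b\<^sup>\<star>\<close>, the orthogonal complement of the range of
  \<open>b\<close>.\<close>

lemma adjoint_b_s: "b\<^sup>\<star> (s\<^sup>\<star> x) = s\<^sup>\<star> (a\<^sup>\<star> x)"
proof -
  have "t\<^sup>\<star> o\<^sub>L b\<^sup>\<star> = a\<^sup>\<star> o\<^sub>L t\<^sup>\<star>"
    using arg_cong[OF bt, of adjoint_operator] by (simp add: adjoint_compose)
  from blinfun_compose_apply_eq[OF this, of "s\<^sup>\<star> x"]
  have "t\<^sup>\<star> (b\<^sup>\<star> (s\<^sup>\<star> x)) = a\<^sup>\<star> x"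
    by simp
  from arg_cong[OF this, of "s\<^sup>\<star>"] show ?thesis
    by simp
qed

lemma norm_a [simp]: "norm (a x) = norm x" and norm_b [simp]: "norm (b x) = norm x"
  by (simp_all add: norm_eq_sqrt_inner inner_adjoint_right)

lemma S_in_M: "S n \<in> M"
  by (induction n) (auto intro!: vn_add vn_compose vn_diff vn_adjoint vn_id M a b t s)

lemma S_Suc_apply: "S (Suc n) x = b (S n (a\<^sup>\<star> x)) + s\<^sup>\<star> (x - a (a\<^sup>\<star> x))"
  by (simp add: blinfun_linear_simps)

lemma S_Suc_a: "S (Suc n) (a x) = b (S n x)"
  unfolding S_Suc_apply by (simp add: blinfun_linear_simps)

text \<open>The correction term vanishes under \<open>b\<^sup>\<star>\<close>, since
  \<open>b\<^sup>\<star> s\<^sup>\<star> (1 - a a\<^sup>\<star>) = s\<^sup>\<star> a\<^sup>\<star>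
  (1 - a a\<^sup>\<star>) = 0\<close>.\<close>

lemma adjoint_b_S_Suc: "b\<^sup>\<star> (S (Suc n) x) = S n (a\<^sup>\<star> x)"
  unfolding S_Suc_apply by (simp add: blinfun_linear_simps adjoint_b_s)

lemma norm_defect_a: "(norm (a\<^sup>\<star> x))\<^sup>2 + (norm (x - a (a\<^sup>\<star> x)))\<^sup>2 = (norm x)\<^sup>2"
  using inner_adjoint_right[of a "a\<^sup>\<star> x" x] inner_adjoint_right[of a "a\<^sup>\<star> x" "a (a\<^sup>\<star> x)"]
    inner_commute[of x "a (a\<^sup>\<star> x)"]
  unfolding power2_norm_eq_inner by (simp add: inner_diff)

text \<open>The two summands of \<open>S (Suc n) x\<close> are orthogonal, as are the components
  \<open>a (a\<^sup>\<star> x)\<close> and \<open>x - a (a\<^sup>\<star> x)\<close> of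
  \<open>x\<close>. By Pythagoras any common bound for \<open>t\<close> and
  \<open>s\<^sup>\<star>\<close> survives the recursion; \<open>norm t + norm s\<close> is
  one.\<close>

lemma norm_S_le: "norm (S n x) \<le> (norm t + norm s) * norm x"
proof -
  have "(norm (S n x))\<^sup>2 \<le> (norm t + norm s)\<^sup>2 * (norm x)\<^sup>2"
  proof (induction n arbitrary: x)
    case 0
    have "norm (t x) \<le> (norm t + norm s) * norm x"
      using norm_blinfun[of t x] by (simp add: distrib_right add_increasing2)
    then show ?case
      by (simp flip: power_mult_distrib)
  next
    case (Suc n)
    define v where "v = s\<^sup>\<star> (x - a (a\<^sup>\<star> x))"
    have "inner (b (S n (a\<^sup>\<star> x))) v = 0"
      by (simp add: inner_adjoint_right v_def adjoint_b_s blinfun_linear_simps)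
    then have "(norm (S (Suc n) x))\<^sup>2 = (norm (S n (a\<^sup>\<star> x)))\<^sup>2 + (norm v)\<^sup>2"
      unfolding S_Suc_apply v_def[symmetric]
      using norm_b[of "S n (a\<^sup>\<star> x)"] by (simp add: dot_norm power2_eq_square)
    moreover have "norm v \<le> (norm t + norm s) * norm (x - a (a\<^sup>\<star> x))"
    proof -
      have "norm v \<le> norm (s\<^sup>\<star>) * norm (x - a (a\<^sup>\<star> x))"
        unfolding v_def by (rule norm_blinfun)
      also have "\<dots> \<le> (norm t + norm s) * norm (x - a (a\<^sup>\<star> x))"
        using norm_adjoint_le[of s] by (intro mult_right_mono) (auto simp: add_increasing)
      finally show ?thesis .
    qed
    then have "(norm v)\<^sup>2 \<le> (norm t + norm s)\<^sup>2 * (norm (x - a (a\<^sup>\<star> x)))\<^sup>2"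
      by (simp flip: power_mult_distrib)
    ultimately have "(norm (S (Suc n) x))\<^sup>2 \<le>
        (norm t + norm s)\<^sup>2 * ((norm (a\<^sup>\<star> x))\<^sup>2 + (norm (x - a (a\<^sup>\<star> x)))\<^sup>2)"
      using Suc[of "a\<^sup>\<star> x"] by (simp add: distrib_left)
    then show ?case
      by (simp only: norm_defect_a)
  qed
  then have "(norm (S n x))\<^sup>2 \<le> ((norm t + norm s) * norm x)\<^sup>2"
    by (simp add: power_mult_distrib)
  then show ?thesis
    by (rule power2_le_imp_le) simp
qed

section \<open>Strong convergence of the approximants\<close>

lemma inner_funpow_a: "inner ((blinfun_apply a ^^ m) x) y = inner x ((blinfun_apply (a\<^sup>\<star>) ^^ m) y)"
  by (induction m arbitrary: y) (simp_all add: inner_adjoint_right funpow_swap1[of "blinfun_apply (a\<^sup>\<star>)"])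

lemma norm_funpow_a [simp]: "norm ((blinfun_apply a ^^ m) x) = norm x"
  and norm_funpow_b [simp]: "norm ((blinfun_apply b ^^ m) x) = norm x"
  by (induction m) simp_all

text \<open>Both sides equal \<open>b^m (t x)\<close>: one by the recursion, the other by
  \<open>b t = t a\<close>.\<close>

lemma S_eq_t_on_range_funpow_a: "S m ((blinfun_apply a ^^ m) x) = t ((blinfun_apply a ^^ m) x)"
proof -
  have "S m ((blinfun_apply a ^^ m) x) = (blinfun_apply b ^^ m) (t x)"
    by (induction m) (simp_all add: S_Suc_a del: reducing_approx.simps(2))
  moreover have "t ((blinfun_apply a ^^ m) x) = (blinfun_apply b ^^ m) (t x)"
    by (induction m) (simp_all flip: b_t)
  ultimately show ?thesis
    by simp
qed

text \<open>The correction term is the same at every step and cancels in the difference, leaving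
  \<open>n\<close> applications of \<open>b\<close> and \<open>a\<^sup>\<star>\<close> around
  \<open>S m - S 0\<close>.\<close>

lemma S_diff: "S (n + m) x - S n x =
    (blinfun_apply b ^^ n) ((S m - t) ((blinfun_apply (a\<^sup>\<star>) ^^ n) x))"
proof (induction n arbitrary: x)
  case 0
  show ?case
    by (simp add: blinfun_linear_simps)
next
  case (Suc n)
  have "S (Suc n + m) x - S (Suc n) x = b (S (n + m) (a\<^sup>\<star> x) - S n (a\<^sup>\<star> x))"
    by (simp add: S_Suc_apply blinfun_linear_simps del: reducing_approx.simps(2))
  then show ?case
    by (simp add: Suc.IH funpow_swap1)
qed

text \<open>Split \<open>y = (a\<^sup>\<star>)^n x\<close> into its projection onto the range of
  \<open>a^m\<close>, where \<open>S m\<close> and \<open>t\<close> agree, and the orthogonal rest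
  \<open>z\<close>. Then \<open>(norm z)\<^sup>2\<close> is the difference on the right, and
  \<open>K\<close> is the square of the bound \<open>(norm t + norm s) + norm t\<close> for
  \<open>S m - t\<close>.\<close>

lemma norm_S_diff_le:
  defines "K \<equiv> (2 * norm t + norm s)\<^sup>2"
  shows "(norm (S (n + m) x - S n x))\<^sup>2 \<le>
    K * ((norm ((blinfun_apply (a\<^sup>\<star>) ^^ n) x))\<^sup>2 - (norm ((blinfun_apply (a\<^sup>\<star>) ^^ (n + m)) x))\<^sup>2)"
proof -
  define y where "y = (blinfun_apply (a\<^sup>\<star>) ^^ n) x"
  define w where "w = (blinfun_apply (a\<^sup>\<star>) ^^ m) y"
  define z where "z = y - (blinfun_apply a ^^ m) w"
  have w: "w = (blinfun_apply (a\<^sup>\<star>) ^^ (n + m)) x"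
    unfolding w_def y_def by (metis add.commute comp_apply funpow_add)
  have "(norm z)\<^sup>2 = (norm y)\<^sup>2 - 2 * inner ((blinfun_apply a ^^ m) w) y + (norm ((blinfun_apply a ^^ m) w))\<^sup>2"
    unfolding z_def power2_norm_eq_inner by (simp add: inner_diff inner_commute)
  then have z: "(norm z)\<^sup>2 = (norm y)\<^sup>2 - (norm w)\<^sup>2"
    by (simp add: inner_funpow_a flip: w_def power2_norm_eq_inner)
  have "norm (S (n + m) x - S n x) = norm ((S m - t) y)"
    by (simp add: S_diff y_def)
  also have "(S m - t) y = S m z - t z"
    by (simp add: z_def blinfun_linear_simps S_eq_t_on_range_funpow_a)
  also have "norm (S m z - t z) \<le> (norm t + norm s) * norm z + norm t * norm z"
    using norm_triangle_ineq4[of "S m z" "t z"] norm_S_le[of m z] norm_blinfun[of t z] by linarith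
  also have "\<dots> = (2 * norm t + norm s) * norm z"
    by (simp add: algebra_simps)
  finally have "(norm (S (n + m) x - S n x))\<^sup>2 \<le> ((2 * norm t + norm s) * norm z)\<^sup>2"
    by simp
  then show ?thesis
    by (simp add: power_mult_distrib z K_def flip: y_def w)
qed

lemma convergent_S: "convergent (\<lambda>n. S n x)"
proof -
  define K where "K = (2 * norm t + norm s)\<^sup>2"
  define d where "d n = K * (norm ((blinfun_apply (a\<^sup>\<star>) ^^ n) x))\<^sup>2" for n
  have le: "(norm (S (n + m) x - S n x))\<^sup>2 \<le> d n - d (n + m)" for n m
    using norm_S_diff_le[of n m x] by (simp add: K_def d_def right_diff_distrib)
  \<comment> \<open>Taking \<open>m = 1\<close> in the estimate already gives monotonicity; a
    nonincreasing nonnegative sequence is Cauchy, and this controls the differences of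
    \<open>S n x\<close>.\<close>
  have "d (Suc n) \<le> d n" for n
    using order_trans[OF zero_le_power2 le[of n 1]] by simp
  then have "decseq d"
    by (rule decseq_SucI)
  moreover have "0 \<le> d n" for n
    by (simp add: d_def K_def)
  ultimately have "convergent d"
    by (metis decseq_convergent convergent_def)
  then have d: "Cauchy d"
    by (rule convergent_Cauchy)
  have "Cauchy (\<lambda>n. S n x)"
  proof (rule CauchyI)
    fix e :: real
    assume "0 < e"
    then obtain N where N: "\<And>i j. N \<le> i \<Longrightarrow> N \<le> j \<Longrightarrow> norm (d i - d j) < e\<^sup>2"
      using CauchyD[OF d, of "e\<^sup>2"] by auto
    have less: "norm (S i x - S j x) < e" if ji: "N \<le> j" "j \<le> i" for i j
    proof -
      obtain m where "i = j + m"
        using ji(2) le_Suc_ex by blast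
      then have "(norm (S i x - S j x))\<^sup>2 < e\<^sup>2"
        using le[of j m] N[of j i] ji by auto
      then show ?thesis
        using \<open>0 < e\<close> by (simp add: power2_less_imp_less)
    qed
    then have "norm (S i x - S j x) < e" if "N \<le> i" "N \<le> j" for i j
      using that by (metis nat_le_linear norm_minus_commute)
    then show "\<exists>N. \<forall>i\<ge>N. \<forall>j\<ge>N. norm (S i x - S j x) < e"
      by blast
  qed
  then show ?thesis
    by (rule Cauchy_convergent)
qed

text \<open>For finite \<open>n\<close> the two intertwining relations hold only up to a shift of
  the index, which disappears in the strong limit.\<close>

lemma reducing_limit:
  obtains L where "L \<in> M" "\<And>x. (\<lambda>n. S n x) \<longlonglongrightarrow> L x"
    "b o\<^sub>L L = L o\<^sub>L a" "b\<^sup>\<star> o\<^sub>L L = L o\<^sub>L a\<^sup>\<star>"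
proof -
  obtain L where L: "\<And>x. (\<lambda>n. S n x) \<longlonglongrightarrow> blinfun_apply L x"
    using bounded_pointwise_limit_blinfun[OF norm_S_le convergent_S] by metis
  have "L \<in> M"
    using S_in_M L by (rule vn_strong_limit[OF M])
  moreover have "b (L x) = L (a x)" for x
  proof (rule LIMSEQ_unique)
    show "(\<lambda>n. S (Suc n) (a x)) \<longlonglongrightarrow> L (a x)"
      by (rule LIMSEQ_Suc[OF L])
    show "(\<lambda>n. S (Suc n) (a x)) \<longlonglongrightarrow> b (L x)"
      unfolding S_Suc_a by (intro tendsto_intros L)
  qed
  then have "b o\<^sub>L L = L o\<^sub>L a"
    by (simp add: blinfun_eq_iff)
  moreover have "b\<^sup>\<star> (L x) = L (a\<^sup>\<star> x)" for x
  proof (rule LIMSEQ_unique)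
    show "(\<lambda>n. b\<^sup>\<star> (S (Suc n) x)) \<longlonglongrightarrow> L (a\<^sup>\<star> x)"
      unfolding adjoint_b_S_Suc by (rule L)
    show "(\<lambda>n. b\<^sup>\<star> (S (Suc n) x)) \<longlonglongrightarrow> b\<^sup>\<star> (L x)"
      by (intro tendsto_intros LIMSEQ_Suc[OF L])
  qed
  then have "b\<^sup>\<star> o\<^sub>L L = L o\<^sub>L a\<^sup>\<star>"
    by (simp add: blinfun_eq_iff)
  ultimately show thesis
    using that L by blast
qed

section \<open>Exchange of the two isometries and invertibility of the limit\<close>

lemma swapped: "similar_isometries M b a s t"
proof
  have "s (b x) = s (b (t (s x)))" for x
    by simp
  then have "a (s x) = s (b x)" for x
    unfolding b_t by simp
  then show "a o\<^sub>L s = s o\<^sub>L b"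
    by (simp add: blinfun_eq_iff)
qed (fact M a b t s ts st)+

text \<open>The approximants are inverse to each other already at finite stages. Inductively, the
  first summand gives \<open>a (a\<^sup>\<star> x)\<close> through
  \<open>b\<^sup>\<star> (S (Suc n) x) = S n (a\<^sup>\<star> x)\<close>, and the second gives
  \<open>x - a (a\<^sup>\<star> x)\<close> through
  \<open>t\<^sup>\<star> s\<^sup>\<star> = 1\<close>.\<close>

lemma swapped_S_S: "reducing_approx b a s t n (S n x) = x"
proof (induction n arbitrary: x)
  case (Suc n)
  interpret inv: similar_isometries M b a s t
    by (rule swapped)
  show ?case
    unfolding inv.S_Suc_apply adjoint_b_S_Suc Suc.IH
    by (simp add: S_Suc_apply del: reducing_approx.simps(2))
qed simp

text \<open>The uniform bound on the exchanged approximants lets the product pass to the strong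
  limit: \<open>x - inv.S n (L x) = inv.S n (S n x - L x)\<close> tends to 0.\<close>

lemma swapped_limit_inverse:
  assumes L: "\<And>x. (\<lambda>n. S n x) \<longlonglongrightarrow> blinfun_apply L x"
    and R: "\<And>x. (\<lambda>n. reducing_approx b a s t n x) \<longlonglongrightarrow> blinfun_apply R x"
  shows "R o\<^sub>L L = id_blinfun"
proof (rule blinfun_eqI)
  fix x
  interpret inv: similar_isometries M b a s t
    by (rule swapped)
  have "(\<lambda>n. S n x - L x) \<longlonglongrightarrow> 0"
    using L by (rule LIM_zero)
  then have "(\<lambda>n. (norm s + norm t) * norm (S n x - L x)) \<longlonglongrightarrow> 0"
    by (intro tendsto_mult_right_zero tendsto_norm_zero)
  then have "(\<lambda>n. inv.S n (S n x - L x)) \<longlonglongrightarrow> 0"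
    by (rule Lim_null_comparison[OF always_eventually[OF allI[OF inv.norm_S_le]]])
  then have "(\<lambda>n. x - inv.S n (L x)) \<longlonglongrightarrow> 0"
    by (simp add: blinfun.diff_right swapped_S_S)
  moreover have "(\<lambda>n. x - inv.S n (L x)) \<longlonglongrightarrow> x - R (L x)"
    by (intro tendsto_intros R)
  ultimately have "x - R (L x) = 0"
    using LIMSEQ_unique by blast
  then show "(R o\<^sub>L L) x = id_blinfun x"
    by simp
qed

lemma unitary_intertwiner: "\<exists>u\<in>M. unitary_operator u \<and> b o\<^sub>L u = u o\<^sub>L a"
proof -
  interpret inv: similar_isometries M b a s t
    by (rule swapped)
  obtain L where L: "L \<in> M" "\<And>x. (\<lambda>n. S n x) \<longlonglongrightarrow> L x"
    "b o\<^sub>L L = L o\<^sub>L a" "b\<^sup>\<star> o\<^sub>L L = L o\<^sub>L a\<^sup>\<star>"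
    using reducing_limit by blast
  obtain R where R: "R \<in> M" "\<And>x. (\<lambda>n. inv.S n x) \<longlonglongrightarrow> R x"
    using inv.reducing_limit by metis
  show ?thesis
    \<comment> \<open>One application of \<open>swapped_limit_inverse\<close> in each direction
      makes \<open>R\<close> a two-sided inverse of \<open>L\<close>.\<close>
    using unitary_intertwiner_of_invertible[OF M a(1) b(1) L(1) R(1)]
      swapped_limit_inverse[OF L(2) R(2)] inv.swapped_limit_inverse[OF R(2) L(2)] L(3,4) by blast
qed

end

theorem theorem3p7:
  fixes M :: "('h::complex_hilbert_space \<Rightarrow>\<^sub>L 'h) set"
    and a b t :: "'h \<Rightarrow>\<^sub>L 'h"
  assumes "von_neumann_algebra M"
    and "a \<in> M" and "isometry_operator a"
    and "b \<in> M" and "isometry_operator b"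
    and "t \<in> M" and "invertible_operator t"
    and "b = t o\<^sub>L a o\<^sub>L inverse_operator t"
  shows "\<exists>u\<in>M. unitary_operator u \<and> b = u o\<^sub>L a o\<^sub>L adjoint_operator u"
proof -
  obtain s where ts: "t o\<^sub>L s = id_blinfun" and st: "s o\<^sub>L t = id_blinfun"
    using assms(7) by (auto simp: invertible_operator_def)
  have "b = t o\<^sub>L a o\<^sub>L s"
    using assms(8) inverse_operator_eqI[OF ts st] by simp
  then have "b o\<^sub>L t = t o\<^sub>L a"
    using st by (simp add: blinfun_eq_iff)
  \<comment> \<open>Invertibility only provides a bounded inverse; its membership in
    \<open>M\<close> comes from \<open>vn_inverse\<close>.\<close>
  then interpret similar_isometries M a b t s
    using assms vn_inverse[OF assms(1,6) ts st] ts st by unfold_locales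
  obtain u where u: "u \<in> M" "unitary_operator u" "b o\<^sub>L u = u o\<^sub>L a"
    using unitary_intertwiner by blast
  have "b = u o\<^sub>L a o\<^sub>L u\<^sup>\<star>"
  proof (rule blinfun_eqI)
    fix x
    have "u (u\<^sup>\<star> x) = x" "b (u (u\<^sup>\<star> x)) = u (a (u\<^sup>\<star> x))"
      using u(2,3) unfolding unitary_operator_def by (auto dest: blinfun_compose_apply_eq)
    then show "b x = (u o\<^sub>L a o\<^sub>L u\<^sup>\<star>) x"
      by simp
  qed
  then show ?thesis
    using u by blast
qed

end
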